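(* Let $\Gamma$ be a countable discrete abelian group such that $2\Gamma = \{2x : x \in \Gamma\}$ is a subgroup of infinite index in $\Gamma$. Then for every $\varepsilon > 0$ there exists a set $A \subseteq \Gamma$ with $d^*(A) > 1 - \varepsilon$ such that whenever $B \subseteq \Gamma$ and $t \in \Gamma$ satisfy $B \oplus B + t \subseteq A$, the set $B$ is finite.
   Context: A Følner sequence in a countable discrete abelian group $\Gamma$ is a sequence $(\Phi_N)_{N \in \mathbb{N}}$ of finite subsets of $\Gamma$ such that $\lim_{N\to\infty} |(\Phi_N + x) \triangle \Phi_N|/|\Phi_N| = 0$ for every $x \in \Gamma$. For a Følner sequence $\Phi$, the upper density along $\Phi$ is $\overline{d}_\Phi(A) = \limsup_{N\to\infty} |A \cap \Phi_N|/|\Phi_N|$. The upper Banach density is $d^*(A) = \sup_\Phi \overline{d}_\Phi(A)$, the supremum over all Følner sequences in $\Gamma$. For $B \subseteq \Gamma$ and $t \in \Gamma$, $B \oplus B + t = \{b_1 + b_2 + t : b_1, b_2 \in B,\ b_1 \neq b_2\}$. *)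

theory Defs
  imports "HOL-Analysis.Analysis"
begin

(* Nonemptiness of each term is implicit in dividing by its cardinality. *)
definition folner_seq :: "(nat \<Rightarrow> 'a::ab_group_add set) \<Rightarrow> bool" where
  "folner_seq \<Phi> \<longleftrightarrow>
     (\<forall>N. finite (\<Phi> N) \<and> \<Phi> N \<noteq> {}) \<and>
     (\<forall>x. (\<lambda>N. real (card (sym_diff ((\<lambda>y. y + x) ` \<Phi> N) (\<Phi> N))) / real (card (\<Phi> N)))
            \<longlonglongrightarrow> 0)"

definition upper_density :: "(nat \<Rightarrow> 'a set) \<Rightarrow> 'a set \<Rightarrow> ereal" where
  "upper_density \<Phi> A = limsup (\<lambda>N. ereal (real (card (A \<inter> \<Phi> N)) / real (card (\<Phi> N))))"

definition upper_banach_density :: "'a::ab_group_add set \<Rightarrow> ereal" where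
  "upper_banach_density A = (SUP \<Phi> \<in> {\<Phi>. folner_seq \<Phi>}. upper_density \<Phi> A)"

definition doubles :: "'a::ab_group_add set" where
  "doubles = range (\<lambda>x. x + x)"

definition cosets :: "'a::ab_group_add set \<Rightarrow> 'a set set" where
  "cosets H = range (\<lambda>x. (\<lambda>h. x + h) ` H)"

definition distinct_sumset_shift :: "'a::ab_group_add set \<Rightarrow> 'a \<Rightarrow> 'a set" where
  "distinct_sumset_shift B t = {b\<^sub>1 + b\<^sub>2 + t | b\<^sub>1 b\<^sub>2. b\<^sub>1 \<in> B \<and> b\<^sub>2 \<in> B \<and> b\<^sub>1 \<noteq> b\<^sub>2}"

end

theory Submission
  imports Defs "HOL-Real_Asymp.Real_Asymp"
begin

text \<open>
  Let \<open>t\<^sub>0, t\<^sub>1, \<dots>\<close> enumerate the group. Choose subgroups \<open>H\<^sub>n\<close> of finite index containing all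
  doubles, the index growing so fast that the densities of the \<open>H\<^sub>n\<close> have a small sum. An infinite
  set \<open>B\<close> has infinitely many elements in one coset of \<open>H\<^sub>n\<close>, and the sum of any two of those lies in
  \<open>H\<^sub>n\<close> because doubles do; so \<open>B \<oplus> B + t\<^sub>n\<close> meets \<open>t\<^sub>n + H\<^sub>n\<close> in an infinite set. It therefore
  suffices to remove from the group \<open>t\<^sub>n + H\<^sub>n\<close> minus a finite set, for every \<open>n\<close>. Taking the finite
  set to be \<open>\<Phi>\<^sub>0 \<union> \<dots> \<union> \<Phi>\<^sub>n\<close> for a Folner sequence \<open>\<Phi>\<close>, only finitely many of the removed sets meet
  each \<open>\<Phi>\<^sub>N\<close>, so the density along \<open>\<Phi>\<close> stays close to 1.
\<close>

section \<open>Subgroups of finite index containing the doubles\<close>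

definition is_subgroup :: "'a::ab_group_add set \<Rightarrow> bool" where
  "is_subgroup H \<longleftrightarrow> 0 \<in> H \<and> (\<forall>x\<in>H. \<forall>y\<in>H. x - y \<in> H)"

lemma is_subgroup_zero: "is_subgroup H \<Longrightarrow> 0 \<in> H"
  by (simp add: is_subgroup_def)

lemma is_subgroup_diff: "is_subgroup H \<Longrightarrow> x \<in> H \<Longrightarrow> y \<in> H \<Longrightarrow> x - y \<in> H"
  by (simp add: is_subgroup_def)

lemma is_subgroup_minus: "is_subgroup H \<Longrightarrow> x \<in> H \<Longrightarrow> - x \<in> H"
  using is_subgroup_diff[of H 0 x] is_subgroup_zero[of H] by simp

lemma is_subgroup_add: "is_subgroup H \<Longrightarrow> x \<in> H \<Longrightarrow> y \<in> H \<Longrightarrow> x + y \<in> H"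
  using is_subgroup_diff[of H x "- y"] is_subgroup_minus[of H y] by simp

lemma is_subgroup_doubles: "is_subgroup (doubles :: 'a::ab_group_add set)"
proof -
  have "(x + x) - (y + y) \<in> doubles" for x y :: 'a
    unfolding doubles_def by (rule range_eqI[of _ _ "x - y"]) (simp add: algebra_simps)
  moreover have "(0::'a) \<in> doubles"
    unfolding doubles_def by (rule range_eqI[of _ _ 0]) simp
  ultimately show ?thesis
    unfolding is_subgroup_def by (auto simp: doubles_def)
qed

lemma infinite_cosets_representatives:
  assumes "is_subgroup H" and "infinite (cosets H)"
  obtains X where "finite X" "card X = n" "\<And>x y. x \<in> X \<Longrightarrow> y \<in> X \<Longrightarrow> x \<noteq> y \<Longrightarrow> x - y \<notin> H"
proof -
  obtain C where C: "C \<subseteq> cosets H" "finite C" "card C = n"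
    using infinite_arbitrarily_large[OF assms(2)] by blast
  obtain X where X: "inj_on (\<lambda>x. (\<lambda>h. x + h) ` H) X" "C = (\<lambda>x. (\<lambda>h. x + h) ` H) ` X"
    using C(1) unfolding cosets_def by (meson subset_image_inj)
  have eq: "(\<lambda>h. x + h) ` H = (\<lambda>h. y + h) ` H" if "x - y \<in> H" for x y
  proof -
    have "x + h \<in> (\<lambda>h. y + h) ` H" if "h \<in> H" for h
      using is_subgroup_add[OF assms(1) \<open>x - y \<in> H\<close> that]
      by (intro image_eqI[of _ _ "x - y + h"]) (auto simp: algebra_simps)
    moreover have "y + h \<in> (\<lambda>h. x + h) ` H" if "h \<in> H" for h
      using is_subgroup_diff[OF assms(1) that \<open>x - y \<in> H\<close>]
      by (intro image_eqI[of _ _ "h - (x - y)"]) (auto simp: algebra_simps)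
    ultimately show ?thesis by blast
  qed
  show thesis
  proof (rule that[of X])
    show "finite X" using C X by (metis finite_imageD)
    show "card X = n" using C X by (metis card_image)
    show "x - y \<notin> H" if "x \<in> X" "y \<in> X" "x \<noteq> y" for x y
      using eq inj_onD[OF X(1)] that by blast
  qed
qed

text \<open>Because \<open>y + y\<close> lies in \<open>H\<close>, the class of \<open>y\<close>
  modulo \<open>H\<close> is its own inverse, so two classes already form a subgroup. This keeps the
  elements gained by adjoining \<open>y\<close> explicit.\<close>

lemma is_subgroup_adjoin:
  fixes H :: "'a::ab_group_add set"
  assumes "is_subgroup H" and "y + y \<in> H"
  shows "is_subgroup (H \<union> (\<lambda>h. h + y) ` H)"
proof -
  let ?K = "H \<union> (\<lambda>h. h + y) ` H"
  have mem: "z \<in> ?K \<longleftrightarrow> z \<in> H \<or> z - y \<in> H" for z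
    by (auto simp: image_iff) (metis diff_add_cancel)
  have "u - v \<in> ?K" if uv: "u \<in> ?K" "v \<in> ?K" for u v
  proof -
    consider "u \<in> H" "v \<in> H" | "u - y \<in> H" "v \<in> H" | "u \<in> H" "v - y \<in> H" | "u - y \<in> H" "v - y \<in> H"
      using uv mem by blast
    then show ?thesis
    proof cases
      case 1
      then show ?thesis using is_subgroup_diff[OF assms(1)] by blast
    next
      case 2
      then have "u - y - v \<in> H" using is_subgroup_diff[OF assms(1)] by blast
      then have "u - v - y \<in> H" by (simp add: algebra_simps)
      then show ?thesis using mem by blast
    next
      case 3
      \<comment> \<open>The only case where \<open>y + y\<close> enters: subtracting it turns the
        class of \<open>- y\<close> into that of \<open>y\<close>.\<close>
      then have "u - (v - y) - (y + y) \<in> H" using is_subgroup_diff[OF assms(1)] assms(2) by blast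
      then have "u - v - y \<in> H" by (simp add: algebra_simps)
      then show ?thesis using mem by blast
    next
      case 4
      then have "(u - y) - (v - y) \<in> H" using is_subgroup_diff[OF assms(1)] by blast
      then have "u - v \<in> H" by (simp add: algebra_simps)
      then show ?thesis by blast
    qed
  qed
  then show ?thesis
    unfolding is_subgroup_def using is_subgroup_zero[OF assms(1)] by blast
qed

text \<open>Zorn's lemma: the union of a nonempty chain of subgroups is a subgroup, and it still
  avoids \<open>D\<close>.\<close>

lemma maximal_subgroup_disjoint_from:
  fixes G D :: "'a::ab_group_add set"
  assumes "is_subgroup G" and "G \<inter> D = {}"
  obtains H where "is_subgroup H" "G \<subseteq> H" "H \<inter> D = {}"
    "\<And>K. is_subgroup K \<Longrightarrow> H \<subseteq> K \<Longrightarrow> K \<inter> D = {} \<Longrightarrow> K = H"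
proof -
  let ?\<A> = "{K. is_subgroup K \<and> G \<subseteq> K \<and> K \<inter> D = {}}"
  have "\<exists>M\<in>?\<A>. \<forall>X\<in>?\<A>. M \<subseteq> X \<longrightarrow> X = M"
  proof (rule subset_Zorn_nonempty)
    show "?\<A> \<noteq> {}" using assms by blast
    fix \<C> assume ne: "\<C> \<noteq> {}" and chain: "subset.chain ?\<A> \<C>"
    have sub: "\<C> \<subseteq> ?\<A>" and tot: "\<And>X Y. X \<in> \<C> \<Longrightarrow> Y \<in> \<C> \<Longrightarrow> X \<subseteq> Y \<or> Y \<subseteq> X"
      using chain by (auto simp: subset_chain_def)
    have "x - y \<in> \<Union>\<C>" if xy: "x \<in> \<Union>\<C>" "y \<in> \<Union>\<C>" for x y
    proof -
      obtain X Y where XY: "X \<in> \<C>" "Y \<in> \<C>" "x \<in> X" "y \<in> Y" using xy by blast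
      then obtain Z where "Z \<in> \<C>" "x \<in> Z" "y \<in> Z" using tot[of X Y] by blast
      then show ?thesis using sub is_subgroup_diff[of Z x y] by blast
    qed
    moreover have "0 \<in> \<Union>\<C>" using ne sub is_subgroup_zero by blast
    ultimately have "is_subgroup (\<Union>\<C>)" unfolding is_subgroup_def by blast
    then show "\<Union>\<C> \<in> ?\<A>" using ne sub by blast
  qed
  then obtain H where H: "H \<in> ?\<A>" "\<forall>X\<in>?\<A>. H \<subseteq> X \<longrightarrow> X = H"
    by (rule bexE)
  show thesis
  proof (rule that[of H])
    show "K = H" if "is_subgroup K" "H \<subseteq> K" "K \<inter> D = {}" for K
    proof -
      have "K \<in> ?\<A>" using H(1) that by auto
      then show ?thesis using H(2) that(2) by simp
    qed
  qed (use H in auto)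
qed

text \<open>
  The subgroup is one that is maximal among those disjoint from the finite set \<open>D\<close> of differences of
  \<open>n\<close> representatives. Adjoining any further \<open>y\<close> produces an element of \<open>D\<close>, so \<open>D \<union> {0}\<close> meets
  every coset, which bounds the index from above.
\<close>

lemma finite_index_subgroup_containing_doubles:
  assumes "infinite (cosets (doubles :: 'a::ab_group_add set))"
  obtains H X C :: "'a::ab_group_add set" where "is_subgroup H" "doubles \<subseteq> H"
    "finite X" "card X = n" "\<And>x y. x \<in> X \<Longrightarrow> y \<in> X \<Longrightarrow> x \<noteq> y \<Longrightarrow> x - y \<notin> H"
    "finite C" "\<And>y. \<exists>c\<in>C. y - c \<in> H"
proof -
  obtain X :: "'a set" where X: "finite X" "card X = n"
    "\<And>x y. x \<in> X \<Longrightarrow> y \<in> X \<Longrightarrow> x \<noteq> y \<Longrightarrow> x - y \<notin> doubles"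
    using infinite_cosets_representatives[OF is_subgroup_doubles assms] by metis
  \<comment> \<open>Avoiding \<open>D\<close> is exactly what keeps the elements of \<open>X\<close>
    in distinct cosets while the subgroup is enlarged.\<close>
  define D where "D = (\<lambda>(x, y). x - y) ` {(x, y) \<in> X \<times> X. x \<noteq> y}"
  have "finite {(x, y) \<in> X \<times> X. x \<noteq> y}"
    by (rule finite_subset[of _ "X \<times> X"]) (use X in auto)
  then have "finite D" unfolding D_def by (rule finite_imageI)
  have "doubles \<inter> D = {}" using X by (auto simp: D_def)
  then obtain H where H: "is_subgroup H" "doubles \<subseteq> H" "H \<inter> D = {}"
    and max: "\<And>K. is_subgroup K \<Longrightarrow> H \<subseteq> K \<Longrightarrow> K \<inter> D = {} \<Longrightarrow> K = H"
    using maximal_subgroup_disjoint_from[OF is_subgroup_doubles] by metis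
  have "\<exists>c\<in>insert 0 D. y - c \<in> H" for y
  proof (cases "y \<in> H")
    case False
    let ?K = "H \<union> (\<lambda>h. h + y) ` H"
    have "is_subgroup ?K"
      by (rule is_subgroup_adjoin) (use H in \<open>auto simp: doubles_def\<close>)
    moreover have "y \<in> ?K" using is_subgroup_zero[OF H(1)] by force
    ultimately have "?K \<inter> D \<noteq> {}" using max[of ?K] False by blast
    then obtain h where h: "h \<in> H" "h + y \<in> D" using H(3) by blast
    have "y - (h + y) \<in> H" using is_subgroup_minus[OF H(1) h(1)] by simp
    then show ?thesis using h by blast
  qed simp
  moreover have "x - y \<notin> H" if "x \<in> X" "y \<in> X" "x \<noteq> y" for x y
  proof -
    have "x - y \<in> D" unfolding D_def using that by force
    then show ?thesis using H(3) by blast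
  qed
  ultimately show thesis
    using that[of H X "insert 0 D"] H X \<open>finite D\<close> by blast
qed

text \<open>By pigeonhole infinitely many elements of \<open>B\<close> lie in one class
  \<open>c + H\<close>. Fixing one of them and varying the other gives infinitely many sums
  congruent to the double \<open>c + c\<close>, hence in \<open>H\<close>.\<close>

lemma infinite_distinct_sums_in_subgroup:
  fixes H C B :: "'a::ab_group_add set"
  assumes H: "is_subgroup H" "doubles \<subseteq> H"
    and C: "finite C" "\<And>y. \<exists>c\<in>C. y - c \<in> H"
    and B: "infinite B"
  shows "infinite (distinct_sumset_shift B t \<inter> (\<lambda>h. t + h) ` H)"
proof -
  have "B \<subseteq> (\<Union>c\<in>C. {b \<in> B. b - c \<in> H})" using C(2) by blast
  then have "\<not> (\<forall>c\<in>C. finite {b \<in> B. b - c \<in> H})"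
    using B C(1) by (meson finite_UN finite_subset)
  then obtain c where c: "infinite {b \<in> B. b - c \<in> H}" by blast
  then obtain b where b: "b \<in> B" "b - c \<in> H"
    using not_finite_existsD by blast
  let ?B = "{b \<in> B. b - c \<in> H} - {b}"
  have "infinite ((\<lambda>b'. b + b' + t) ` ?B)"
    using c by (subst finite_image_iff) (auto simp: inj_on_def)
  moreover have "(\<lambda>b'. b + b' + t) ` ?B \<subseteq> distinct_sumset_shift B t \<inter> (\<lambda>h. t + h) ` H"
  proof (intro image_subsetI IntI)
    fix b' assume b': "b' \<in> ?B"
    show "b + b' + t \<in> distinct_sumset_shift B t"
      using b b' by (auto simp: distinct_sumset_shift_def)
    have "c + c \<in> H" using H(2) by (auto simp: doubles_def)
    then have "(b - c) + (b' - c) + (c + c) \<in> H"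
      using b b' is_subgroup_add[OF H(1)] by blast
    then have "b + b' \<in> H" by (simp add: algebra_simps)
    then show "b + b' + t \<in> (\<lambda>h. t + h) ` H" by (auto simp: add.commute)
  qed
  ultimately show ?thesis using finite_subset by blast
qed

section \<open>Folner sets\<close>

text \<open>Iteration gives \<open>f n \<ge> f 0 * c ^ n\<close>, which outgrows every fixed power
  of \<open>Suc n\<close>.\<close>

lemma exp_growth_not_poly_bounded:
  fixes f :: "nat \<Rightarrow> real"
  assumes "c > 1" and "f 0 > 0" and "\<And>n. f (Suc n) > c * f n"
  obtains n where "f n > real (Suc n) ^ d"
proof (rule ccontr)
  assume "\<not> thesis"
  then have le: "f n \<le> real (Suc n) ^ d" for n using that by (meson not_le)
  have ge: "f n \<ge> f 0 * c ^ n" for n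
  proof (induction n)
    case (Suc n)
    have "f 0 * c ^ Suc n = c * (f 0 * c ^ n)" by simp
    also have "\<dots> \<le> c * f n" using Suc assms(1) by (intro mult_left_mono) auto
    finally show ?case using assms(3)[of n] by linarith
  qed simp
  have "(\<lambda>n. real (Suc n) ^ d / c ^ n) \<longlonglongrightarrow> 0"
    using assms(1) by real_asymp
  then have "eventually (\<lambda>n. real (Suc n) ^ d / c ^ n < f 0) sequentially"
    using assms(2) by (rule order_tendstoD)
  then obtain n where "real (Suc n) ^ d / c ^ n < f 0"
    by (auto simp: eventually_sequentially)
  then have "real (Suc n) ^ d < f 0 * c ^ n"
    using assms(1) by (simp add: field_simps)
  then show False using le[of n] ge[of n] by linarith
qed

text \<open>A translate has the same size as \<open>F\<close>, so either half of the symmetric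
  difference controls the other.\<close>

lemma card_translate_Diff:
  fixes F :: "'a::ab_group_add set"
  assumes "finite F"
  shows "card (F - (\<lambda>y. y + x) ` F) = card ((\<lambda>y. y + x) ` F - F)"
proof -
  have "card ((\<lambda>y. y + x) ` F) = card F" by (rule card_image) (auto simp: inj_on_def)
  then show ?thesis
    using assms card_Diff_subset_Int[of F "(\<lambda>y. y + x) ` F"]
      card_Diff_subset_Int[of "(\<lambda>y. y + x) ` F" F] by (simp add: Int_commute)
qed

text \<open>
  The sets of combinations \<open>\<Sum>s\<in>S. k\<^sub>s s\<close> with \<open>0 \<le> k\<^sub>s \<le> n\<close> have polynomially bounded size, so
  passing from \<open>n\<close> to \<open>n + 1\<close> must multiply the size by less than \<open>1 + \<eta>\<close> for some \<open>n\<close>.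
\<close>

lemma exists_almost_invariant_set:
  fixes S :: "'a::ab_group_add set"
  assumes S: "finite S" and \<eta>: "\<eta> > 0"
  obtains F where "finite F" "F \<noteq> {}"
    "\<And>s. s \<in> S \<Longrightarrow> real (card ((\<lambda>y. y + s) ` F - F)) \<le> \<eta> * real (card F)"
proof -
  \<comment> \<open>The inner sum is the multiple of \<open>s\<close> by the natural number
    \<open>k s\<close>.\<close>
  define comb where "comb = (\<lambda>k :: 'a \<Rightarrow> nat. \<Sum>s\<in>S. \<Sum>_<k s. s)"
  define F where "F = (\<lambda>n. comb ` (S \<rightarrow>\<^sub>E {..n}))"
  have fin: "finite (F n)" for n
    unfolding F_def by (intro finite_imageI finite_PiE S) auto
  have ne: "F n \<noteq> {}" for n
    unfolding F_def by (simp add: PiE_eq_empty_iff)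
  have bound: "card (F n) \<le> Suc n ^ card S" for n
  proof -
    have "card (F n) \<le> card (S \<rightarrow>\<^sub>E {..n})"
      unfolding F_def by (intro card_image_le finite_PiE S) auto
    then show ?thesis using S by (simp add: card_PiE)
  qed
  have mono: "F n \<subseteq> F (Suc n)" for n
    unfolding F_def by (intro image_mono PiE_mono) auto
  have step: "(\<lambda>y. y + s) ` F n \<subseteq> F (Suc n)" if s: "s \<in> S" for s n
  proof clarify
    fix y assume "y \<in> F n"
    then obtain k where k: "k \<in> S \<rightarrow>\<^sub>E {..n}" "y = comb k" by (auto simp: F_def)
    \<comment> \<open>Translation by \<open>s\<close> raises one coefficient by one, so it stays
      within the next set.\<close>
    have "comb (k(s := Suc (k s))) = comb k + s"
      using s S by (simp add: comb_def sum.remove[of S s] algebra_simps)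
    moreover have "k(s := Suc (k s)) \<in> S \<rightarrow>\<^sub>E {..Suc n}"
      using k(1) s by (auto simp: PiE_iff extensional_def le_SucI)
    ultimately show "y + s \<in> F (Suc n)"
      unfolding F_def using k(2) by (metis imageI)
  qed
  obtain n where n: "real (card (F (Suc n))) \<le> (1 + \<eta>) * real (card (F n))"
  proof (rule ccontr)
    assume "\<not> thesis"
    then have "real (card (F (Suc n))) > (1 + \<eta>) * real (card (F n))" for n
      using that by (meson not_le)
    moreover have "real (card (F 0)) > 0" using fin ne by (simp add: card_gt_0_iff)
    ultimately obtain n where "real (card (F n)) > real (Suc n) ^ card S"
      using exp_growth_not_poly_bounded[of "1 + \<eta>" "\<lambda>n. real (card (F n))" "card S"] \<eta> by auto
    moreover have "real (card (F n)) \<le> real (Suc n) ^ card S"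
      using bound[of n] by (metis of_nat_le_iff of_nat_power)
    ultimately show False by linarith
  qed
  show thesis
  proof (rule that[of "F n"])
    fix s assume s: "s \<in> S"
    have "card ((\<lambda>y. y + s) ` F n - F n) \<le> card (F (Suc n) - F n)"
      using step[OF s, of n] fin by (intro card_mono) auto
    also have "\<dots> = card (F (Suc n)) - card (F n)"
      using mono fin by (simp add: card_Diff_subset)
    finally have "real (card ((\<lambda>y. y + s) ` F n - F n)) \<le> real (card (F (Suc n))) - real (card (F n))"
      using card_mono[OF fin mono, of n] by linarith
    then show "real (card ((\<lambda>y. y + s) ` F n - F n)) \<le> \<eta> * real (card (F n))"
      using n by (simp add: algebra_simps)
  qed (use fin ne in auto)
qed

text \<open>A one-sided estimate suffices up to a factor 2. It is asked only eventually for each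
  \<open>x\<close>, so \<open>\<Phi> N\<close> may be built to handle finitely many translations at
  a time.\<close>

lemma folner_seqI:
  fixes \<Phi> :: "nat \<Rightarrow> 'a::ab_group_add set"
  assumes "\<And>N. finite (\<Phi> N)" and "\<And>N. \<Phi> N \<noteq> {}"
    and small: "\<And>x. eventually (\<lambda>N. real (card ((\<lambda>y. y + x) ` \<Phi> N - \<Phi> N)) \<le> \<eta> N * real (card (\<Phi> N))) sequentially"
    and \<eta>: "\<eta> \<longlonglongrightarrow> 0"
  shows "folner_seq \<Phi>"
  unfolding folner_seq_def
proof (intro conjI allI)
  fix x
  let ?r = "\<lambda>N. real (card (sym_diff ((\<lambda>y. y + x) ` \<Phi> N) (\<Phi> N))) / real (card (\<Phi> N))"
  have "eventually (\<lambda>N. ?r N \<le> 2 * \<eta> N) sequentially"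
    using small[of x]
  proof eventually_elim
    case (elim N)
    have "card (sym_diff ((\<lambda>y. y + x) ` \<Phi> N) (\<Phi> N)) \<le> 2 * card ((\<lambda>y. y + x) ` \<Phi> N - \<Phi> N)"
      using card_Un_le[of "(\<lambda>y. y + x) ` \<Phi> N - \<Phi> N" "\<Phi> N - (\<lambda>y. y + x) ` \<Phi> N"]
        card_translate_Diff[OF assms(1), of N x] by simp
    then have "real (card (sym_diff ((\<lambda>y. y + x) ` \<Phi> N) (\<Phi> N))) \<le> 2 * \<eta> N * real (card (\<Phi> N))"
      using elim by linarith
    moreover have "real (card (\<Phi> N)) > 0" using assms(1,2) by (simp add: card_gt_0_iff)
    ultimately show ?case by (simp add: divide_le_eq)
  qed
  moreover have "(\<lambda>N. 2 * \<eta> N) \<longlonglongrightarrow> 0" using tendsto_mult_right_zero[OF \<eta>] .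
  ultimately show "?r \<longlonglongrightarrow> 0"
    by (intro tendsto_sandwich[of "\<lambda>_. 0" ?r sequentially "\<lambda>N. 2 * \<eta> N"]) auto
qed (use assms in auto)

text \<open>Each translate of \<open>R\<close> meets \<open>F\<close> in almost as many points as
  \<open>R\<close> does, and the disjoint translates must fit into \<open>F\<close> together. So
  \<open>R\<close> has density at most \<open>1 / card X + \<eta>\<close> in \<open>F\<close> when
  \<open>X\<close> is nonempty.\<close>

lemma card_Int_disjoint_translates:
  fixes F R X :: "'a::ab_group_add set"
  assumes "finite F" and X: "finite X"
    and disj: "\<And>x y. x \<in> X \<Longrightarrow> y \<in> X \<Longrightarrow> x \<noteq> y \<Longrightarrow> (\<lambda>r. r + x) ` R \<inter> (\<lambda>r. r + y) ` R = {}"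
    and inv: "\<And>x. x \<in> X \<Longrightarrow> real (card ((\<lambda>y. y + x) ` F - F)) \<le> \<eta> * real (card F)"
  shows "real (card X) * real (card (R \<inter> F)) \<le> (1 + real (card X) * \<eta>) * real (card F)"
proof -
  have "real (card (R \<inter> F)) \<le> real (card ((\<lambda>r. r + x) ` R \<inter> F)) + \<eta> * real (card F)" if "x \<in> X" for x
  proof -
    have "card (R \<inter> F) = card ((\<lambda>r. r + x) ` (R \<inter> F))"
      by (rule card_image[symmetric]) (auto simp: inj_on_def)
    \<comment> \<open>A translated point either stays in \<open>F\<close> or is counted among those
      that leave it.\<close>
    also have "\<dots> \<le> card (((\<lambda>r. r + x) ` R \<inter> F) \<union> ((\<lambda>y. y + x) ` F - F))"
      using assms(1) by (intro card_mono) auto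
    also have "\<dots> \<le> card ((\<lambda>r. r + x) ` R \<inter> F) + card ((\<lambda>y. y + x) ` F - F)"
      by (rule card_Un_le)
    finally show ?thesis using inv[OF that] by linarith
  qed
  then have "(\<Sum>x\<in>X. real (card (R \<inter> F))) \<le> (\<Sum>x\<in>X. real (card ((\<lambda>r. r + x) ` R \<inter> F)) + \<eta> * real (card F))"
    by (rule sum_mono)
  also have "\<dots> = real (\<Sum>x\<in>X. card ((\<lambda>r. r + x) ` R \<inter> F)) + real (card X) * \<eta> * real (card F)"
    by (simp add: sum.distrib)
  also have "(\<Sum>x\<in>X. card ((\<lambda>r. r + x) ` R \<inter> F)) = card (\<Union>x\<in>X. (\<lambda>r. r + x) ` R \<inter> F)"
    using X assms(1) disj by (intro card_UN_disjoint[symmetric]) blast+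
  also have "real \<dots> \<le> real (card F)"
    using assms(1) by (intro of_nat_mono card_mono) auto
  finally show ?thesis by (simp add: algebra_simps)
qed

lemma coset_translates_disjoint:
  fixes H :: "'a::ab_group_add set"
  assumes "is_subgroup H" and "x - y \<notin> H"
  shows "(\<lambda>r. r + x) ` (\<lambda>h. t + h) ` H \<inter> (\<lambda>r. r + y) ` (\<lambda>h. t + h) ` H = {}"
proof (rule ccontr)
  assume "\<not> ?thesis"
  then obtain h h' where h: "h \<in> H" "h' \<in> H" "t + h + x = t + h' + y" by auto
  then have "x - y = h' - h" by (simp add: algebra_simps)
  then show False using is_subgroup_diff[OF assms(1) h(2,1)] assms(2) by simp
qed

section \<open>Sets of large density without infinite restricted sumsets\<close>

theorem theorem1p2:
  fixes \<epsilon> :: real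
  assumes "countable (UNIV :: 'a::ab_group_add set)"
    and "infinite (cosets (doubles :: 'a set))"
    and "\<epsilon> > 0"
  shows "\<exists>A :: 'a set. upper_banach_density A > ereal (1 - \<epsilon>) \<and>
           (\<forall>B t. distinct_sumset_shift B t \<subseteq> A \<longrightarrow> finite B)"
proof -
  define t :: "nat \<Rightarrow> 'a" where "t = from_nat_into UNIV"
  have surj_t: "surj t"
    unfolding t_def using range_from_nat_into[OF UNIV_not_empty assms(1)] by simp
  \<comment> \<open>With \<open>M n = K * 2 ^ n\<close>, the density bound \<open>2 / M n\<close>
    found below is at most \<open>\<epsilon> / 4 * (1/2) ^ n\<close>.\<close>
  obtain K :: nat where K: "real K > 8 / \<epsilon>" using reals_Archimedean2 by blast
  have "8 / \<epsilon> > 0" using assms(3) by simp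
  then have K0: "real K > 0" using K by linarith
  define M where "M = (\<lambda>n::nat. K * 2 ^ n)"
  have M0: "M n > 0" for n using K0 by (simp add: M_def)

  have "\<exists>H X C :: 'a set. is_subgroup H \<and> doubles \<subseteq> H \<and> finite X \<and> card X = M n \<and>
      (\<forall>x\<in>X. \<forall>y\<in>X. x \<noteq> y \<longrightarrow> x - y \<notin> H) \<and> finite C \<and> (\<forall>y. \<exists>c\<in>C. y - c \<in> H)" for n
    by (rule finite_index_subgroup_containing_doubles[OF assms(2), of "M n"]) blast
  then obtain H X C :: "nat \<Rightarrow> 'a set" where H: "\<And>n. is_subgroup (H n)" "\<And>n. doubles \<subseteq> H n"
    and X: "\<And>n. finite (X n)" "\<And>n. card (X n) = M n"
    and XH: "\<And>n x y. x \<in> X n \<Longrightarrow> y \<in> X n \<Longrightarrow> x \<noteq> y \<Longrightarrow> x - y \<notin> H n"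
    and C: "\<And>n. finite (C n)" "\<And>n y. \<exists>c\<in>C n. y - c \<in> H n"
    by metis
  define R where "R = (\<lambda>n. (\<lambda>h. t n + h) ` H n)"
  \<comment> \<open>The factor \<open>M N\<close> ensures \<open>M n * \<eta> N \<le> 1\<close> for
    \<open>n < N\<close>, so the invariance error at most doubles the ideal density
    \<open>1 / M n\<close>.\<close>
  define \<eta> where "\<eta> = (\<lambda>N. 1 / (real (Suc N) * real (M N)))"
  \<comment> \<open>The initial shifts yield the Folner property; the sets \<open>X n\<close> yield
    the sparsity of \<open>R n\<close> in \<open>\<Phi> N\<close>.\<close>
  define S where "S = (\<lambda>N. t ` {..N} \<union> (\<Union>n<N. X n))"
  have "\<exists>F. finite F \<and> F \<noteq> {} \<and> (\<forall>s\<in>S N. real (card ((\<lambda>y. y + s) ` F - F)) \<le> \<eta> N * real (card F))" for N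
  proof -
    have "finite (S N)" and "\<eta> N > 0" using X M0 by (auto simp: S_def \<eta>_def)
    then show ?thesis by (rule exists_almost_invariant_set[of "S N" "\<eta> N"]) blast
  qed
  then obtain \<Phi> where \<Phi>: "\<And>N. finite (\<Phi> N)" "\<And>N. \<Phi> N \<noteq> {}"
    and inv: "\<And>N s. s \<in> S N \<Longrightarrow> real (card ((\<lambda>y. y + s) ` \<Phi> N - \<Phi> N)) \<le> \<eta> N * real (card (\<Phi> N))"
    by metis

  have folner: "folner_seq \<Phi>"
  proof (rule folner_seqI[OF \<Phi>])
    fix x
    obtain m where "x = t m" using surj_t by (metis surjD)
    then have "x \<in> S N" if "N \<ge> m" for N using that by (auto simp: S_def)
    then show "eventually (\<lambda>N. real (card ((\<lambda>y. y + x) ` \<Phi> N - \<Phi> N)) \<le> \<eta> N * real (card (\<Phi> N))) sequentially"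
      using inv by (auto simp: eventually_sequentially)
  next
    show "\<eta> \<longlonglongrightarrow> 0"
      unfolding \<eta>_def M_def using K0 by real_asymp
  qed

  have sparse: "real (card (R n \<inter> \<Phi> N)) \<le> \<epsilon> / 4 * (1/2) ^ n * real (card (\<Phi> N))" if "n < N" for n N
  proof -
    have "M n \<le> M N" using that by (simp add: M_def)
    then have "real (M n) * 1 \<le> real (M N) * real (Suc N)"
      by (intro mult_mono) auto
    then have "real (M n) * \<eta> N \<le> 1"
      using M0[of N] by (simp add: \<eta>_def divide_le_eq mult.commute)
    moreover have "real (card (X n)) * real (card (R n \<inter> \<Phi> N))
        \<le> (1 + real (card (X n)) * \<eta> N) * real (card (\<Phi> N))"
    proof (rule card_Int_disjoint_translates[OF \<Phi>(1) X(1)])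
      show "real (card ((\<lambda>y. y + x) ` \<Phi> N - \<Phi> N)) \<le> \<eta> N * real (card (\<Phi> N))" if "x \<in> X n" for x
        using that \<open>n < N\<close> by (intro inv) (auto simp: S_def)
    qed (use coset_translates_disjoint[OF H(1) XH] in \<open>simp add: R_def\<close>)
    ultimately have le: "real (M n) * real (card (R n \<inter> \<Phi> N)) \<le> 2 * real (card (\<Phi> N))"
      using X(2) mult_right_mono[of "1 + real (M n) * \<eta> N" 2 "real (card (\<Phi> N))"] by auto
    have "8 \<le> \<epsilon> * real K" using K assms(3) by (simp add: field_simps)
    then have "2 \<le> \<epsilon> / 4 * (1/2) ^ n * real (M n)"
      by (simp add: M_def power_one_over)
    then have "2 * real (card (\<Phi> N)) \<le> \<epsilon> / 4 * (1/2) ^ n * real (M n) * real (card (\<Phi> N))"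
      by (rule mult_right_mono) simp
    with le have "real (M n) * real (card (R n \<inter> \<Phi> N)) \<le> real (M n) * (\<epsilon> / 4 * (1/2) ^ n * real (card (\<Phi> N)))"
      by (simp add: mult_ac)
    then show ?thesis using M0[of n] by (simp add: mult_le_cancel_left_pos)
  qed

  define A where "A = - (\<Union>n. R n - (\<Union>m\<le>n. \<Phi> m))"
  have dense: "1 - \<epsilon> / 2 \<le> real (card (A \<inter> \<Phi> N)) / real (card (\<Phi> N))" for N
  proof -
    \<comment> \<open>For \<open>n \<ge> N\<close> the set \<open>\<Phi> N\<close> is exempt from
      the removal of \<open>R n\<close>, so only \<open>n < N\<close> can cost density.\<close>
    have "\<Phi> N \<subseteq> (A \<inter> \<Phi> N) \<union> (\<Union>n<N. R n \<inter> \<Phi> N)"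
      unfolding A_def using not_le by blast
    then have "card (\<Phi> N) \<le> card ((A \<inter> \<Phi> N) \<union> (\<Union>n<N. R n \<inter> \<Phi> N))"
      using \<Phi>(1) by (intro card_mono) auto
    also have "\<dots> \<le> card (A \<inter> \<Phi> N) + card (\<Union>n<N. R n \<inter> \<Phi> N)"
      by (rule card_Un_le)
    also have "card (\<Union>n<N. R n \<inter> \<Phi> N) \<le> (\<Sum>n<N. card (R n \<inter> \<Phi> N))"
      by (rule card_UN_le) simp
    finally have "real (card (\<Phi> N)) \<le> real (card (A \<inter> \<Phi> N)) + (\<Sum>n<N. real (card (R n \<inter> \<Phi> N)))"
      by (simp flip: of_nat_sum of_nat_add)
    also have "(\<Sum>n<N. real (card (R n \<inter> \<Phi> N))) \<le> (\<Sum>n<N. \<epsilon> / 4 * (1/2) ^ n * real (card (\<Phi> N)))"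
      using sparse by (intro sum_mono) auto
    also have "\<dots> = \<epsilon> / 4 * real (card (\<Phi> N)) * (\<Sum>n<N. (1/2) ^ n)"
      by (simp add: sum_distrib_left mult_ac)
    \<comment> \<open>The geometric sum is below 2, so the total loss is at most
      \<open>\<epsilon> / 2\<close>.\<close>
    also have "\<dots> \<le> \<epsilon> / 4 * real (card (\<Phi> N)) * 2"
      using assms(3) by (intro mult_left_mono) (auto simp: sum_gp_strict)
    finally have "(1 - \<epsilon> / 2) * real (card (\<Phi> N)) \<le> real (card (A \<inter> \<Phi> N))"
      by (simp add: algebra_simps)
    moreover have "real (card (\<Phi> N)) > 0" using \<Phi> by (simp add: card_gt_0_iff)
    ultimately show ?thesis by (simp add: le_divide_eq)
  qed
  \<comment> \<open>The spare \<open>\<epsilon> / 2\<close> provides strictness, since the limsup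
    inherits only a weak inequality.\<close>
  have "ereal (1 - \<epsilon>) < ereal (1 - \<epsilon> / 2)" using assms(3) by simp
  also have "\<dots> \<le> upper_density \<Phi> A"
    unfolding upper_density_def
    by (rule le_Limsup) (use dense in auto)
  also have "\<dots> \<le> upper_banach_density A"
    unfolding upper_banach_density_def using folner by (intro SUP_upper) simp
  finally have "upper_banach_density A > ereal (1 - \<epsilon>)" .
  moreover have "finite B" if B: "distinct_sumset_shift B s \<subseteq> A" for B s
  proof (rule ccontr)
    assume "infinite B"
    obtain n where n: "s = t n" using surj_t by (metis surjD)
    have "infinite (distinct_sumset_shift B s \<inter> R n)"
      using infinite_distinct_sums_in_subgroup[OF H C \<open>infinite B\<close>] by (simp add: R_def n)
    \<comment> \<open>Inside \<open>A\<close>, the coset \<open>R n\<close> survives only in the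
      finite exempted set, which cannot hold infinitely many sums.\<close>
    moreover have "distinct_sumset_shift B s \<inter> R n \<subseteq> (\<Union>m\<le>n. \<Phi> m)"
      using B unfolding A_def by blast
    ultimately show False using \<Phi>(1) by (meson finite_UN finite_atMost finite_subset)
  qed
  ultimately show ?thesis by blast
qed

end
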